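(* Let $n\ge 1$ and let $H$ be a non-negative self-adjoint operator on $L^2(\mathbb{R}^n)$. Assume that there are $\gamma>0$ and a constant $C_0>0$ such that $$\|e^{-tH}\|_{L^2\to L^\infty}\le C_0t^{-\gamma}\quad\text{for all } t>0.$$ Then there is a constant $C>0$ such that for any $R>0$ there is a constant $\delta_R>0$ such that for all $f\in L^2(\mathbb{R}^n)$, $$\|f\|^2\le C\left(\|\chi(|x|\ge R)f\|^2+\|\chi(H\ge\delta_R)f\|^2\right).$$
   Context: $\|\cdot\|$ is the norm of $L^2(\mathbb{R}^n)$. $\chi(\Omega)$ stands for the characteristic function of $\Omega$: $\chi(|x|\ge R)$ is multiplication by the indicator function of $\{|x|\ge R\}$, and $\chi(H\ge\delta)$ is the spectral projection of $H$ onto $[\delta,\infty)$. *)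

theory Defs
  imports "HOL-Probability.Essential_Supremum"
begin

section \<open>The complex Hilbert space \<open>L\<^sup>2\<close>\<close>

definition square_integrable :: "('a::euclidean_space \<Rightarrow> complex) \<Rightarrow> bool" where
  "square_integrable f \<longleftrightarrow>
     f \<in> borel_measurable lborel \<and> integrable lborel (\<lambda>x. (cmod (f x))\<^sup>2)"

definition l2_rel :: "('a::euclidean_space \<Rightarrow> complex) \<Rightarrow> ('a \<Rightarrow> complex) \<Rightarrow> bool" where
  "l2_rel f g \<longleftrightarrow> square_integrable f \<and> square_integrable g \<and> (AE x in lborel. f x = g x)"

lemma square_integrable_zero: "square_integrable (\<lambda>x. 0)"
  by (simp add: square_integrable_def)

lemma square_integrable_add:
  assumes "square_integrable f" "square_integrable g"
  shows "square_integrable (\<lambda>x. f x + g x)"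
proof -
  have m[measurable]: "f \<in> borel_measurable lborel" "g \<in> borel_measurable lborel"
    using assms by (auto simp: square_integrable_def)
  have "integrable lborel (\<lambda>x. (cmod (f x + g x))\<^sup>2)"
  proof (rule Bochner_Integration.integrable_bound)
    show "integrable lborel (\<lambda>x. 2 * (cmod (f x))\<^sup>2 + 2 * (cmod (g x))\<^sup>2)"
      using assms by (auto simp: square_integrable_def)
    show "AE x in lborel. norm ((cmod (f x + g x))\<^sup>2) \<le> norm (2 * (cmod (f x))\<^sup>2 + 2 * (cmod (g x))\<^sup>2)"
    proof (rule AE_I2)
      fix x
      have "(cmod (f x + g x))\<^sup>2 \<le> (cmod (f x) + cmod (g x))\<^sup>2"
        by (simp add: norm_triangle_ineq power_mono)
      also have "\<dots> \<le> 2 * (cmod (f x))\<^sup>2 + 2 * (cmod (g x))\<^sup>2"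
        using sum_squares_bound[of "cmod (f x)" "cmod (g x)"] by (simp add: power2_sum)
      finally show "norm ((cmod (f x + g x))\<^sup>2) \<le> norm (2 * (cmod (f x))\<^sup>2 + 2 * (cmod (g x))\<^sup>2)"
        by simp
    qed
  qed simp
  then show ?thesis by (simp add: square_integrable_def)
qed

lemma square_integrable_scale:
  assumes "square_integrable f"
  shows "square_integrable (\<lambda>x. c * f x)"
  using assms by (auto simp: square_integrable_def norm_mult power_mult_distrib)

lemma square_integrable_mult_cnj:
  assumes "square_integrable f" "square_integrable g"
  shows "integrable lborel (\<lambda>x. f x * cnj (g x))"
proof (rule Bochner_Integration.integrable_bound)
  have m[measurable]: "f \<in> borel_measurable lborel" "g \<in> borel_measurable lborel"
    using assms by (auto simp: square_integrable_def)
  show "integrable lborel (\<lambda>x. (cmod (f x))\<^sup>2 + (cmod (g x))\<^sup>2)"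
    using assms by (auto simp: square_integrable_def)
  have "(\<lambda>x. cnj (g x)) \<in> borel_measurable lborel"
    by (rule borel_measurable_continuous_on[of cnj]) (auto intro: continuous_intros)
  then show "(\<lambda>x. f x * cnj (g x)) \<in> borel_measurable lborel"
    by measurable
  show "AE x in lborel. norm (f x * cnj (g x)) \<le> norm ((cmod (f x))\<^sup>2 + (cmod (g x))\<^sup>2)"
  proof (rule AE_I2)
    fix x
    have "0 \<le> cmod (f x) * cmod (g x)" by simp
    then have "cmod (f x) * cmod (g x) \<le> (cmod (f x))\<^sup>2 + (cmod (g x))\<^sup>2"
      using sum_squares_bound[of "cmod (f x)" "cmod (g x)"] by linarith
    then show "norm (f x * cnj (g x)) \<le> norm ((cmod (f x))\<^sup>2 + (cmod (g x))\<^sup>2)"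
      by (simp add: norm_mult)
  qed
qed

text \<open>Borel representatives suffice: every Lebesgue measurable function agrees almost everywhere
  with a Borel measurable one.\<close>

quotient_type (overloaded) 'a l2 = "'a::euclidean_space \<Rightarrow> complex" / partial: "l2_rel"
proof (rule part_equivpI)
  show "\<exists>f::'a \<Rightarrow> complex. l2_rel f f"
    using square_integrable_zero by (auto simp: l2_rel_def)
  show "symp (l2_rel :: ('a \<Rightarrow> complex) \<Rightarrow> _)"
    by (rule sympI) (auto simp: l2_rel_def)
  show "transp (l2_rel :: ('a \<Rightarrow> complex) \<Rightarrow> _)"
    by (rule transpI) (auto simp: l2_rel_def elim: eventually_elim2)
qed

lift_definition scaleC_l2 :: "complex \<Rightarrow> 'a::euclidean_space l2 \<Rightarrow> 'a l2" (infixr \<open>*\<^sub>C\<close> 75)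
  is "\<lambda>c f x. c * f x"
  by (auto simp: l2_rel_def intro: square_integrable_scale elim: eventually_mono)

lift_definition cinner_l2 :: "'a::euclidean_space l2 \<Rightarrow> 'a l2 \<Rightarrow> complex"
  is "\<lambda>f g. LINT x|lborel. f x * cnj (g x)"
proof -
  fix f f' g g' :: "'a \<Rightarrow> complex"
  assume f: "l2_rel f f'" and g: "l2_rel g g'"
  show "(LINT x|lborel. f x * cnj (g x)) = (LINT x|lborel. f' x * cnj (g' x))"
  proof (rule integral_cong_AE)
    show "(\<lambda>x. f x * cnj (g x)) \<in> borel_measurable lborel"
         "(\<lambda>x. f' x * cnj (g' x)) \<in> borel_measurable lborel"
      using f g unfolding l2_rel_def
      by (blast intro: borel_measurable_integrable square_integrable_mult_cnj)+
    have "AE x in lborel. f x = f' x" "AE x in lborel. g x = g' x"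
      using f g by (auto simp: l2_rel_def)
    then show "AE x in lborel. f x * cnj (g x) = f' x * cnj (g' x)"
      by eventually_elim simp
  qed
qed

lemma l2_rel_norm_cong:
  assumes "l2_rel f g"
  shows "(LINT x|lborel. (cmod (f x))\<^sup>2) = (LINT x|lborel. (cmod (g x))\<^sup>2)"
  using assms
  by (intro integral_cong_AE) (auto simp: l2_rel_def square_integrable_def elim: eventually_mono)

instantiation l2 :: (euclidean_space) real_vector
begin

lift_definition zero_l2 :: "'a l2" is "\<lambda>x. 0"
  by (simp add: l2_rel_def square_integrable_zero)

lift_definition plus_l2 :: "'a l2 \<Rightarrow> 'a l2 \<Rightarrow> 'a l2" is "\<lambda>f g x. f x + g x"
  by (auto simp: l2_rel_def intro: square_integrable_add elim: eventually_elim2)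

lift_definition uminus_l2 :: "'a l2 \<Rightarrow> 'a l2" is "\<lambda>f x. - f x"
  by (auto simp: l2_rel_def square_integrable_def elim: eventually_mono)

definition minus_l2 :: "'a l2 \<Rightarrow> 'a l2 \<Rightarrow> 'a l2" where
  "minus_l2 f g = f + - g"

definition scaleR_l2 :: "real \<Rightarrow> 'a l2 \<Rightarrow> 'a l2" where
  "scaleR_l2 r f = complex_of_real r *\<^sub>C f"

instance
proof
  fix f g h :: "'a l2" and r s :: real
  show "f + g + h = f + (g + h)"
    by transfer (auto simp: l2_rel_def add.assoc intro!: square_integrable_add)
  show "f + g = g + f"
    by transfer (auto simp: l2_rel_def add.commute intro!: square_integrable_add)
  show "0 + f = f"
    by transfer (auto simp: l2_rel_def)
  show "- f + f = 0"
    by transfer (auto simp: l2_rel_def square_integrable_zero)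
  show "f - g = f + - g"
    by (simp add: minus_l2_def)
  show "r *\<^sub>R (f + g) = r *\<^sub>R f + r *\<^sub>R g"
    unfolding scaleR_l2_def
    by transfer (auto simp: l2_rel_def distrib_left intro!: square_integrable_add square_integrable_scale)
  show "(r + s) *\<^sub>R f = r *\<^sub>R f + s *\<^sub>R f"
    unfolding scaleR_l2_def
    by transfer (auto simp: l2_rel_def distrib_right simp flip: distrib_right intro!: square_integrable_add square_integrable_scale)
  show "r *\<^sub>R s *\<^sub>R f = (r * s) *\<^sub>R f"
    unfolding scaleR_l2_def
    by transfer (auto simp: l2_rel_def mult.assoc intro!: square_integrable_scale)
  show "1 *\<^sub>R f = f"
    unfolding scaleR_l2_def
    by transfer (auto simp: l2_rel_def)
qed

end

instantiation l2 :: (euclidean_space) real_inner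
begin

lift_definition norm_l2 :: "'a l2 \<Rightarrow> real" is "\<lambda>f. sqrt (LINT x|lborel. (cmod (f x))\<^sup>2)"
  by (simp add: l2_rel_norm_cong)

definition inner_l2 :: "'a l2 \<Rightarrow> 'a l2 \<Rightarrow> real" where
  "inner_l2 f g = Re (cinner_l2 f g)"

definition dist_l2 :: "'a l2 \<Rightarrow> 'a l2 \<Rightarrow> real" where
  "dist_l2 f g = norm (f - g)"

definition sgn_l2 :: "'a l2 \<Rightarrow> 'a l2" where
  "sgn_l2 f = f /\<^sub>R norm f"

definition uniformity_l2 :: "('a l2 \<times> 'a l2) filter" where
  "uniformity_l2 = (INF e\<in>{0<..}. principal {(f, g). dist f g < e})"

definition open_l2 :: "'a l2 set \<Rightarrow> bool" where
  "open_l2 U \<longleftrightarrow> (\<forall>f\<in>U. eventually (\<lambda>(f', g). f' = f \<longrightarrow> g \<in> U) uniformity)"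

instance
proof
  fix f g h :: "'a l2" and r :: real and U :: "'a l2 set"
  have self: "Re (cinner_l2 k k) = (norm k)\<^sup>2" for k :: "'a l2"
  proof transfer
    fix k :: "'a \<Rightarrow> complex"
    assume "l2_rel k k"
    have "Re (LINT x|lborel. k x * cnj (k x)) = Re (LINT x|lborel. complex_of_real ((cmod (k x))\<^sup>2))"
      by (simp add: complex_norm_square flip: of_real_power)
    also have "\<dots> = (LINT x|lborel. (cmod (k x))\<^sup>2)"
      by (simp only: integral_complex_of_real Re_complex_of_real)
    finally show "Re (LINT x|lborel. k x * cnj (k x)) = (sqrt (LINT x|lborel. (cmod (k x))\<^sup>2))\<^sup>2"
      by simp
  qed
  have nn: "0 \<le> norm k" for k :: "'a l2"
    by transfer simp
  show "dist f g = norm (f - g)"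
    by (simp add: dist_l2_def)
  show "sgn f = f /\<^sub>R norm f"
    by (simp add: sgn_l2_def)
  show "(uniformity :: ('a l2 \<times> 'a l2) filter) = (INF e\<in>{0<..}. principal {(f, g). dist f g < e})"
    by (simp add: uniformity_l2_def)
  show "open U \<longleftrightarrow> (\<forall>f\<in>U. eventually (\<lambda>(f', g). f' = f \<longrightarrow> g \<in> U) uniformity)"
    by (simp add: open_l2_def)
  show "inner f g = inner g f"
    unfolding inner_l2_def
  proof transfer
    fix f g :: "'a \<Rightarrow> complex"
    assume "l2_rel f f" "l2_rel g g"
    have "(LINT x|lborel. f x * cnj (g x)) = (LINT x|lborel. cnj (g x * cnj (f x)))"
      by (simp add: mult.commute)
    also have "\<dots> = cnj (LINT x|lborel. g x * cnj (f x))"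
      by (rule Bochner_Integration.integral_cnj)
    finally show "Re (LINT x|lborel. f x * cnj (g x)) = Re (LINT x|lborel. g x * cnj (f x))"
      by simp
  qed
  show "inner (f + g) h = inner f h + inner g h"
    unfolding inner_l2_def
    by transfer (auto simp: l2_rel_def distrib_right Bochner_Integration.integral_add square_integrable_mult_cnj)
  show "inner (r *\<^sub>R f) g = r * inner f g"
    unfolding inner_l2_def scaleR_l2_def
    by transfer (auto simp: l2_rel_def mult.assoc)
  show "0 \<le> inner f f"
    by (simp add: inner_l2_def self)
  show "norm f = sqrt (inner f f)"
    by (simp add: inner_l2_def self nn)
  have "norm f = 0 \<longleftrightarrow> f = 0"
  proof transfer
    fix f :: "'a \<Rightarrow> complex"
    assume f: "l2_rel f f"
    have "(sqrt (LINT x|lborel. (cmod (f x))\<^sup>2) = 0) \<longleftrightarrow> (AE x in lborel. (cmod (f x))\<^sup>2 = 0)"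
      using f by (subst real_sqrt_eq_zero_cancel_iff, intro integral_nonneg_eq_0_iff_AE)
        (auto simp: l2_rel_def square_integrable_def)
    also have "\<dots> \<longleftrightarrow> l2_rel f (\<lambda>x. 0)"
      using f by (auto simp: l2_rel_def square_integrable_zero)
    finally show "(sqrt (LINT x|lborel. (cmod (f x))\<^sup>2) = 0) = l2_rel f (\<lambda>x. 0)" .
  qed
  then show "inner f f = 0 \<longleftrightarrow> f = 0"
    by (simp add: inner_l2_def self)
qed

end

text \<open>Multiplication by the indicator function of \<open>{x. R \<le> |x|}\<close>.\<close>

lift_definition cutoff_ge :: "real \<Rightarrow> 'a::euclidean_space l2 \<Rightarrow> 'a l2"
  is "\<lambda>R f x. indicator {x. R \<le> norm x} x * f x"
proof -
  fix R :: real and f g :: "'a \<Rightarrow> complex"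
  have "square_integrable (\<lambda>x. indicator {x. R \<le> norm x} x * h x)"
    if h: "square_integrable h" for h :: "'a \<Rightarrow> complex"
  proof -
    have m[measurable]: "h \<in> borel_measurable lborel"
      using h by (auto simp: square_integrable_def)
    have "integrable lborel (\<lambda>x. (cmod (indicator {x. R \<le> norm x} x * h x))\<^sup>2)"
      by (rule Bochner_Integration.integrable_bound[of _ "\<lambda>x. (cmod (h x))\<^sup>2"])
        (use h in \<open>auto simp: square_integrable_def indicator_def\<close>)
    then show ?thesis
      by (simp add: square_integrable_def)
  qed
  then show "l2_rel f g \<Longrightarrow> l2_rel (\<lambda>x. indicator {x. R \<le> norm x} x * f x)
      (\<lambda>x. indicator {x. R \<le> norm x} x * g x)"
    by (auto simp: l2_rel_def elim: eventually_mono)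
qed

lift_definition Linf_norm :: "'a::euclidean_space l2 \<Rightarrow> ereal"
  is "\<lambda>f. esssup lborel (\<lambda>x. ereal (cmod (f x)))"
  by (rule esssup_AE_cong) (auto simp: l2_rel_def square_integrable_def elim: eventually_mono)

definition L2_Linf_norm :: "('a::euclidean_space l2 \<Rightarrow> 'a l2) \<Rightarrow> ereal" where
  "L2_Linf_norm T = (SUP f\<in>{f. norm f \<le> 1}. Linf_norm (T f))"


section \<open>Unbounded operators\<close>

text \<open>An operator on \<open>L\<^sup>2\<close> is a domain \<open>D\<close> together with a function whose values outside \<open>D\<close>
  are irrelevant.\<close>

definition clinear_on :: "'a::euclidean_space l2 set \<Rightarrow> ('a l2 \<Rightarrow> 'a l2) \<Rightarrow> bool" where
  "clinear_on D T \<longleftrightarrow> 0 \<in> D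
     \<and> (\<forall>f\<in>D. \<forall>g\<in>D. f + g \<in> D \<and> T (f + g) = T f + T g)
     \<and> (\<forall>c. \<forall>f\<in>D. c *\<^sub>C f \<in> D \<and> T (c *\<^sub>C f) = c *\<^sub>C T f)"

definition adjoint_graph ::
    "'a::euclidean_space l2 set \<Rightarrow> ('a l2 \<Rightarrow> 'a l2) \<Rightarrow> ('a l2 \<times> 'a l2) set" where
  "adjoint_graph D T = {(g, h). \<forall>f\<in>D. cinner_l2 (T f) g = cinner_l2 f h}"

definition self_adjoint :: "'a::euclidean_space l2 set \<Rightarrow> ('a l2 \<Rightarrow> 'a l2) \<Rightarrow> bool" where
  "self_adjoint D T \<longleftrightarrow> clinear_on D T \<and> closure D = UNIV \<and> adjoint_graph D T = {(f, T f) | f. f \<in> D}"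

definition nonnegative_op :: "'a::euclidean_space l2 set \<Rightarrow> ('a l2 \<Rightarrow> 'a l2) \<Rightarrow> bool" where
  "nonnegative_op D T \<longleftrightarrow> (\<forall>f\<in>D. cinner_l2 (T f) f \<in> \<real> \<and> 0 \<le> Re (cinner_l2 (T f) f))"


section \<open>Spectral measures and functional calculus\<close>

text \<open>Only the values of \<open>E\<close> on Borel sets matter.\<close>

definition projection_valued_measure ::
    "(real set \<Rightarrow> 'a::euclidean_space l2 \<Rightarrow> 'a l2) \<Rightarrow> bool" where
  "projection_valued_measure E \<longleftrightarrow>
     (\<forall>S\<in>sets borel. clinear_on UNIV (E S)
        \<and> (\<forall>f g. cinner_l2 (E S f) g = cinner_l2 f (E S g)))
     \<and> (\<forall>S\<in>sets borel. \<forall>S'\<in>sets borel. \<forall>f. E (S \<inter> S') f = E S (E S' f))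
     \<and> (\<forall>f. E UNIV f = f)
     \<and> (\<forall>A f. range A \<subseteq> sets borel \<longrightarrow> disjoint_family A \<longrightarrow>
          (\<lambda>i. E (A i) f) sums E (\<Union>i::nat. A i) f)"

text \<open>The scalar measure \<open>S \<mapsto> \<langle>E S f, f\<rangle>\<close>.\<close>

definition scalar_measure ::
    "(real set \<Rightarrow> 'a::euclidean_space l2 \<Rightarrow> 'a l2) \<Rightarrow> 'a l2 \<Rightarrow> real measure" where
  "scalar_measure E f =
     measure_of UNIV (sets borel) (\<lambda>S. ennreal (Re (cinner_l2 (E S f) f)))"

text \<open>\<open>T\<close> with domain \<open>D\<close> is the operator \<open>\<integral> \<phi> dE\<close>. Its quadratic form determines it, by
  polarization and density of its domain.\<close>

definition is_spectral_integral ::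
    "(real set \<Rightarrow> 'a::euclidean_space l2 \<Rightarrow> 'a l2) \<Rightarrow> (real \<Rightarrow> real)
      \<Rightarrow> 'a l2 set \<Rightarrow> ('a l2 \<Rightarrow> 'a l2) \<Rightarrow> bool" where
  "is_spectral_integral E \<phi> D T \<longleftrightarrow>
     D = {f. integrable (scalar_measure E f) (\<lambda>s. (\<phi> s)\<^sup>2)}
     \<and> clinear_on D T
     \<and> (\<forall>f\<in>D. cinner_l2 (T f) f = complex_of_real (LINT s|scalar_measure E f. \<phi> s))"

text \<open>\<open>E\<close> is the spectral measure of the self-adjoint operator \<open>T\<close> with domain \<open>D\<close>, that is
  \<open>T = \<integral> \<lambda> dE(\<lambda>)\<close>. By the spectral theorem it exists and is unique (on Borel sets), and
  \<open>\<chi>(T \<ge> \<delta>)\<close> is \<open>E {\<delta>..}\<close>.\<close>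

definition spectral_measure_of ::
    "'a::euclidean_space l2 set \<Rightarrow> ('a l2 \<Rightarrow> 'a l2) \<Rightarrow> (real set \<Rightarrow> 'a l2 \<Rightarrow> 'a l2) \<Rightarrow> bool" where
  "spectral_measure_of D T E \<longleftrightarrow> projection_valued_measure E \<and> is_spectral_integral E (\<lambda>s. s) D T"

text \<open>\<open>\<phi>(T) = \<integral> \<phi> dE\<close> for \<open>\<phi>\<close> that is bounded on the support of \<open>E\<close>, so that the domain is
  all of \<open>L\<^sup>2\<close>.\<close>

definition functional_calculus ::
    "(real set \<Rightarrow> 'a::euclidean_space l2 \<Rightarrow> 'a l2) \<Rightarrow> (real \<Rightarrow> real) \<Rightarrow> 'a l2 \<Rightarrow> 'a l2" where
  "functional_calculus E \<phi> = (THE T. is_spectral_integral E \<phi> UNIV T)"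

end

theory Submission
  imports Defs
begin

text \<open>
The statement is an uncertainty principle: a function whose energy is below a small \<open>\<delta>\<close> cannot
have much of its mass inside a fixed ball. Write \<open>Q = \<chi>(|x| < R)\<close> and \<open>P = \<chi>(H < \<delta>)\<close>. If
\<open>\<parallel>Q P\<parallel> \<le> 1/2\<close>, then \<open>\<parallel>Q f\<parallel> \<le> \<parallel>f\<parallel> / 2 + \<parallel>(1 - P) f\<parallel>\<close>, hence
\<open>\<parallel>f\<parallel>\<^sup>2 = \<parallel>(1 - Q) f\<parallel>\<^sup>2 + \<parallel>Q f\<parallel>\<^sup>2 \<le> \<parallel>(1 - Q) f\<parallel>\<^sup>2 + \<parallel>f\<parallel>\<^sup>2 / 2 + 2 \<parallel>(1 - P) f\<parallel>\<^sup>2\<close>, and the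
term \<open>\<parallel>f\<parallel>\<^sup>2 / 2\<close> is absorbed on the left; so \<open>C = 4\<close> works for every \<open>R\<close>.

To make \<open>Q P\<close> small, put \<open>T = e\<^sup>-\<^sup>t\<^sup>H\<close>. The hypothesis bounds \<open>\<parallel>Q T\<parallel>\<close> by
\<open>C\<^sub>0 t\<^sup>-\<^sup>\<gamma> sqrt |B\<^sub>R|\<close> (lemma \<open>norm_cutoff_lt_le_L2_Linf\<close>), and by symmetry \<open>T Q\<close> obeys the same
bound. Since \<open>T\<close> is at least \<open>e\<^sup>-\<^sup>t\<^sup>\<delta>\<close> on the range of \<open>P\<close>, one has
\<open>\<parallel>P u\<parallel> \<le> e\<^sup>t\<^sup>\<delta> \<parallel>T u\<parallel>\<close> (lemma \<open>norm_E_lessThan_le_heat\<close>). Together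
\<open>\<parallel>Q P\<parallel> = \<parallel>P Q\<parallel> \<le> e\<^sup>t\<^sup>\<delta> C\<^sub>0 t\<^sup>-\<^sup>\<gamma> sqrt |B\<^sub>R|\<close> (lemma \<open>norm_cutoff_lt_E_lessThan_le\<close>). With
\<open>t = 1 / \<delta>\<close> the right-hand side is \<open>e C\<^sub>0 \<delta>\<^sup>\<gamma> sqrt |B\<^sub>R|\<close>, which tends to \<open>0\<close> with \<open>\<delta>\<close>.

The semigroup is given only through its description \<open>functional_calculus\<close>, so it must be shown
that exactly one operator fits it. Existence (\<open>bounded_functional_calculus_exists\<close>) rests on the
completeness of \<open>L\<^sup>2\<close>, uniqueness (\<open>is_spectral_integral_unique\<close>) on polarization. That
\<open>e\<^sup>-\<^sup>t\<^sup>H\<close> is bounded requires that the spectral measure of a non-negative operator lives on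
\<open>[0, \<infinity>)\<close> (\<open>E_negative_eq_0\<close>).
\<close>

section \<open>The inner product of \<open>L\<^sup>2\<close>\<close>

lemma minus_l2_transfer [transfer_rule]:
  includes lifting_syntax
  shows "(pcr_l2 (=) ===> pcr_l2 (=) ===> pcr_l2 (=)) (\<lambda>f g x. f x - g x)
    (minus :: 'a::euclidean_space l2 \<Rightarrow> _)"
proof -
  have "(pcr_l2 (=) ===> pcr_l2 (=) ===> pcr_l2 (=)) (\<lambda>f g x. f x + - g x)
      (\<lambda>f g. f + - g :: 'a::euclidean_space l2)"
    by transfer_prover
  then show ?thesis
    by (simp only: minus_l2_def[abs_def] diff_conv_add_uminus)
qed

lemma l2_exhaust:
  obtains F where "square_integrable F" "f = abs_l2 F"
proof -
  have "l2_rel (rep_l2 f) (rep_l2 f)"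
    by (rule Quotient_rep_reflp[OF Quotient_l2])
  moreover have "f = abs_l2 (rep_l2 f)"
    by (rule Quotient_abs_rep[OF Quotient_l2, symmetric])
  ultimately show thesis using that by (auto simp: l2_rel_def)
qed

lemma cinner_scaleC_left: "cinner_l2 (c *\<^sub>C f) g = c * cinner_l2 f g"
  by transfer (simp add: mult.assoc)

lemma cinner_add_left: "cinner_l2 (f + g) h = cinner_l2 f h + cinner_l2 g h"
  by transfer (auto simp: l2_rel_def distrib_right Bochner_Integration.integral_add square_integrable_mult_cnj)

lemma cinner_commute: "cinner_l2 f g = cnj (cinner_l2 g f)"
proof transfer
  fix f g :: "'a \<Rightarrow> complex"
  have "(LINT x|lborel. f x * cnj (g x)) = (LINT x|lborel. cnj (g x * cnj (f x)))"
    by (simp add: mult.commute)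
  also have "\<dots> = cnj (LINT x|lborel. g x * cnj (f x))"
    by (rule Bochner_Integration.integral_cnj)
  finally show "(LINT x|lborel. f x * cnj (g x)) = cnj (LINT x|lborel. g x * cnj (f x))" .
qed

lemma cinner_scaleC_right: "cinner_l2 f (c *\<^sub>C g) = cnj c * cinner_l2 f g"
  by (metis cinner_commute cinner_scaleC_left complex_cnj_mult)

lemma scaleC_of_real: "complex_of_real r *\<^sub>C f = r *\<^sub>R f"
  by (simp add: scaleR_l2_def)

lemma scaleC_add_right: "c *\<^sub>C (f + g) = c *\<^sub>C f + c *\<^sub>C g"
  by transfer (auto simp: l2_rel_def distrib_left intro!: square_integrable_add square_integrable_scale)

lemma scaleC_scaleC: "c *\<^sub>C (d *\<^sub>C f) = (c * d) *\<^sub>C f"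
  by transfer (auto simp: l2_rel_def mult.assoc intro!: square_integrable_scale)

lemma norm_scaleC: "norm (c *\<^sub>C f) = cmod c * norm f"
  by transfer (simp add: norm_mult power_mult_distrib real_sqrt_mult)

lemma Im_cinner: "Im (cinner_l2 f g) = inner f (\<i> *\<^sub>C g)"
  by (simp add: inner_l2_def cinner_scaleC_right)

lemma cinner_self: "cinner_l2 f f = complex_of_real ((norm f)\<^sup>2)"
proof (rule complex_eqI)
  show "Re (cinner_l2 f f) = Re (complex_of_real ((norm f)\<^sup>2))"
    using power2_norm_eq_inner[of f] by (simp add: inner_l2_def)
  have "Im (cinner_l2 f f) = - Im (cinner_l2 f f)"
    by (subst cinner_commute) simp
  then show "Im (cinner_l2 f f) = Im (complex_of_real ((norm f)\<^sup>2))" by simp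
qed

lemma bounded_linear_scaleC: "bounded_linear (\<lambda>f::'a::euclidean_space l2. c *\<^sub>C f)"
proof (rule bounded_linear_intro[where K="cmod c"])
  show "c *\<^sub>C r *\<^sub>R x = r *\<^sub>R c *\<^sub>C x" for r and x :: "'a l2"
    by (simp add: scaleC_scaleC mult.commute flip: scaleC_of_real)
qed (simp_all add: scaleC_add_right norm_scaleC mult.commute)

text \<open>Continuity of the complex inner product follows from the real Cauchy-Schwarz inequality, applied
to the real part and, through \<open>Im_cinner\<close>, to the imaginary part; the resulting bound
\<open>2 \<parallel>f\<parallel> \<parallel>g\<parallel>\<close> is crude but suffices for passing to limits.\<close>

lemma bounded_linear_cinner_left: "bounded_linear (\<lambda>f::'a::euclidean_space l2. cinner_l2 f g)"
proof (rule bounded_linear_intro[where K="2 * norm g"])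
  show "cinner_l2 (r *\<^sub>R x) g = r *\<^sub>R cinner_l2 x g" for r and x :: "'a l2"
    by (simp add: cinner_scaleC_left scaleR_conv_of_real flip: scaleC_of_real)
  show "norm (cinner_l2 x g) \<le> norm x * (2 * norm g)" for x :: "'a l2"
  proof -
    have "norm (cinner_l2 x g) \<le> \<bar>Re (cinner_l2 x g)\<bar> + \<bar>Im (cinner_l2 x g)\<bar>"
      by (rule cmod_le)
    also have "\<dots> \<le> norm x * norm g + norm x * norm (\<i> *\<^sub>C g)"
      unfolding Im_cinner unfolding inner_l2_def[symmetric]
      by (intro add_mono Cauchy_Schwarz_ineq2)
    finally show ?thesis by (simp add: norm_scaleC mult_ac)
  qed
qed (simp_all add: cinner_add_left)

section \<open>Completeness of \<open>L\<^sup>2\<close>\<close>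

lemma l2_rel_refl_iff: "l2_rel f f \<longleftrightarrow> square_integrable f"
  by (auto simp: l2_rel_def)

lemma square_integrable_diff:
  assumes "square_integrable f" "square_integrable g"
  shows "square_integrable (\<lambda>x. f x - g x)"
  using square_integrable_add[OF assms(1) square_integrable_scale[OF assms(2), of "-1"]] by simp

lemma norm_abs_l2_diff:
  assumes "square_integrable f" "square_integrable g"
  shows "(norm (abs_l2 f - abs_l2 g))\<^sup>2 = (LINT x|lborel. (cmod (f x - g x))\<^sup>2)"
proof -
  have "abs_l2 f - abs_l2 g = abs_l2 (\<lambda>x. f x + - g x)"
    using assms unfolding minus_l2_def
    by (subst uminus_l2.abs_eq plus_l2.abs_eq; simp add: l2_rel_refl_iff square_integrable_diff)+
       (use square_integrable_scale[OF assms(2), of "-1"] in simp)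
  then show ?thesis
    using square_integrable_diff[OF assms] by (simp add: norm_l2.abs_eq l2_rel_refl_iff)
qed

text \<open>The heart of the Riesz-Fischer theorem. Because the norms of the increments
decay like \<open>4\<^sup>-\<^sup>k\<close>, even the
weighted sum \<open>\<Sum> 4\<^sup>k |F\<^sub>k\<^sub>+\<^sub>1 - F\<^sub>k|\<^sup>2\<close> of the representatives has finite integral,
hence is finite almost everywhere; there \<open>|F\<^sub>k\<^sub>+\<^sub>1 - F\<^sub>k| \<le> c 2\<^sup>-\<^sup>k\<close> and \<open>F\<^sub>k\<close> converges pointwise.
Working with squares, the integral of the sum is the sum of the squared norms. Fatou's lemma then
turns pointwise convergence into convergence in norm.\<close>

lemma l2_fast_Cauchy_convergent:
  fixes X :: "nat \<Rightarrow> 'a::euclidean_space l2"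
  assumes fast: "\<And>k. norm (X (Suc k) - X k) \<le> (1/4) ^ k" and Cau: "Cauchy X"
  shows "convergent X"
proof -
  have "\<exists>F. square_integrable F \<and> X k = abs_l2 F" for k
    by (rule l2_exhaust[of "X k"]) auto
  then obtain F where F: "\<And>k. square_integrable (F k)" "\<And>k. X k = abs_l2 (F k)"
    by metis
  have [measurable]: "F k \<in> borel_measurable lborel" for k
    using F(1)[of k] by (simp add: square_integrable_def)
  have nn: "(\<integral>\<^sup>+x. ennreal ((cmod (F j x - F k x))\<^sup>2) \<partial>lborel) = ennreal ((norm (X j - X k))\<^sup>2)" for j k
    using square_integrable_diff[OF F(1)[of j] F(1)[of k]]
    by (simp add: F(2) norm_abs_l2_diff[OF F(1) F(1)] nn_integral_eq_integral square_integrable_def)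
  define S where "S x = (\<Sum>k. ennreal (4 ^ k * (cmod (F (Suc k) x - F k x))\<^sup>2))" for x
  have [measurable]: "S \<in> borel_measurable lborel"
    unfolding S_def by measurable
  have "(\<integral>\<^sup>+x. S x \<partial>lborel) = (\<Sum>k. \<integral>\<^sup>+x. ennreal (4 ^ k * (cmod (F (Suc k) x - F k x))\<^sup>2) \<partial>lborel)"
    unfolding S_def by (rule nn_integral_suminf) measurable
  also have "\<dots> = (\<Sum>k. ennreal (4 ^ k * (norm (X (Suc k) - X k))\<^sup>2))"
    by (simp add: ennreal_mult nn_integral_cmult nn)
  also have "\<dots> \<le> (\<Sum>k. ennreal ((1/4) ^ k))"
  proof (intro suminf_le ennreal_leI)
    fix k
    have "4 ^ k * (norm (X (Suc k) - X k))\<^sup>2 \<le> 4 ^ k * ((1/4) ^ k)\<^sup>2"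
      using fast[of k] by (intro mult_left_mono power_mono) auto
    also have "\<dots> = (4 * (1/4) * (1/4)) ^ k"
      by (simp add: power2_eq_square power_mult_distrib power_divide)
    finally show "4 ^ k * (norm (X (Suc k) - X k))\<^sup>2 \<le> (1/4) ^ k" by simp
  qed auto
  also have "\<dots> = ennreal (\<Sum>k. (1/4) ^ k)"
    by (rule suminf_ennreal2) (auto intro: summable_geometric)
  finally have "(\<integral>\<^sup>+x. S x \<partial>lborel) \<noteq> \<infinity>"
    by (auto simp: top_unique)
  then have "AE x in lborel. S x \<noteq> \<infinity>"
    by (intro nn_integral_noteq_infinite) auto
  then have AEconv: "AE x in lborel. convergent (\<lambda>k. F k x)"
  proof eventually_elim
    case (elim x)
    have "\<exists>c. \<forall>k. 4 ^ k * (cmod (F (Suc k) x - F k x))\<^sup>2 \<le> c\<^sup>2"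
    proof -
      obtain r where r: "S x = ennreal r" "r \<ge> 0"
        using elim by (cases "S x") auto
      have "4 ^ k * (cmod (F (Suc k) x - F k x))\<^sup>2 \<le> r" for k
      proof -
        have "(\<Sum>i\<in>{k}. ennreal (4 ^ i * (cmod (F (Suc i) x - F i x))\<^sup>2)) \<le> S x"
          unfolding S_def by (rule sum_le_suminf) auto
        then show ?thesis using r by simp
      qed
      then show ?thesis using r by (intro exI[of _ "sqrt r"]) auto
    qed
    then obtain c where c: "\<And>k. 4 ^ k * (cmod (F (Suc k) x - F k x))\<^sup>2 \<le> c\<^sup>2" by auto
    have "cmod (F (Suc k) x - F k x) \<le> \<bar>c\<bar> * (1/2) ^ k" for k
    proof -
      have "(2 ^ k * cmod (F (Suc k) x - F k x))\<^sup>2 \<le> c\<^sup>2"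
      proof -
        have "(2 ^ k)\<^sup>2 = (4::real) ^ k"
          by (simp add: power2_eq_square flip: power_mult_distrib)
        then show ?thesis using c[of k] by (simp only: power_mult_distrib)
      qed
      then have "2 ^ k * cmod (F (Suc k) x - F k x) \<le> \<bar>c\<bar>"
        by (metis abs_le_square_iff abs_of_nonneg mult_nonneg_nonneg norm_ge_zero zero_le_numeral zero_le_power)
      then show ?thesis by (simp add: power_divide field_simps)
    qed
    then have "summable (\<lambda>k. F (Suc k) x - F k x)"
      by (intro summable_comparison_test[OF _ summable_mult[OF summable_geometric[of "1/2::real"], of "\<bar>c\<bar>"]]) auto
    then have "convergent (\<lambda>n. \<Sum>k<n. F (Suc k) x - F k x)"
      by (simp add: summable_iff_convergent)
    then have "convergent (\<lambda>n. F n x - F 0 x)"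
      unfolding sum_lessThan_telescope[of "\<lambda>k. F k x"] .
    then show ?case
      by (simp add: convergent_diff_const_right_iff)
  qed
  define G where "G x = lim (\<lambda>k. F k x)" for x
  have [measurable]: "G \<in> borel_measurable lborel"
    unfolding G_def by (rule borel_measurable_lim_metric) measurable
  have AElim: "AE x in lborel. (\<lambda>k. F k x) \<longlonglongrightarrow> G x"
    using AEconv by eventually_elim (simp add: G_def convergent_LIMSEQ_iff)
  have Fatou: "(\<integral>\<^sup>+x. ennreal ((cmod (G x - F k x))\<^sup>2) \<partial>lborel) \<le> ennreal (e\<^sup>2)"
    if "\<forall>j\<ge>k. norm (X j - X k) \<le> e" for e k
  proof -
    have "(\<integral>\<^sup>+x. ennreal ((cmod (G x - F k x))\<^sup>2) \<partial>lborel)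
        = (\<integral>\<^sup>+x. liminf (\<lambda>j. ennreal ((cmod (F j x - F k x))\<^sup>2)) \<partial>lborel)"
    proof (rule nn_integral_cong_AE)
      show "AE x in lborel. ennreal ((cmod (G x - F k x))\<^sup>2) = liminf (\<lambda>j. ennreal ((cmod (F j x - F k x))\<^sup>2))"
        using AElim
      proof eventually_elim
        case (elim x)
        have "(\<lambda>j. ennreal ((cmod (F j x - F k x))\<^sup>2)) \<longlonglongrightarrow> ennreal ((cmod (G x - F k x))\<^sup>2)"
          by (intro tendsto_intros elim)
        then show ?case by (metis lim_imp_Liminf trivial_limit_sequentially)
      qed
    qed
    also have "\<dots> \<le> liminf (\<lambda>j. \<integral>\<^sup>+x. ennreal ((cmod (F j x - F k x))\<^sup>2) \<partial>lborel)"
      by (rule nn_integral_liminf) measurable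
    also have "\<dots> = liminf (\<lambda>j. ennreal ((norm (X j - X k))\<^sup>2))"
      by (simp add: nn)
    also have "\<dots> \<le> ennreal (e\<^sup>2)"
    proof (rule Liminf_le)
      show "\<forall>\<^sub>F j in sequentially. ennreal ((norm (X j - X k))\<^sup>2) \<le> ennreal (e\<^sup>2)"
        using eventually_ge_at_top[of k]
        by eventually_elim (use that in \<open>auto intro!: ennreal_leI power_mono\<close>)
    qed auto
    finally show ?thesis .
  qed
  have tail: "\<exists>K. \<forall>k\<ge>K. \<forall>j\<ge>k. norm (X j - X k) \<le> e" if "e > 0" for e
    using Cau that unfolding Cauchy_def dist_norm by (metis less_imp_le order_trans)
  have G: "square_integrable G"
  proof -
    obtain K where K: "\<forall>j\<ge>K. norm (X j - X K) \<le> 1"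
      using tail[of 1] by auto
    have "integrable lborel (\<lambda>x. (cmod (G x - F K x))\<^sup>2)"
      using Fatou[OF K] by (intro integrableI_bounded) (auto simp: le_less_trans)
    then have "square_integrable (\<lambda>x. G x - F K x)"
      by (simp add: square_integrable_def)
    from square_integrable_add[OF this F(1)[of K]] show ?thesis by simp
  qed
  have "X \<longlonglongrightarrow> abs_l2 G"
  proof (rule LIMSEQ_I)
    fix r :: real assume "r > 0"
    then obtain K where K: "\<forall>k\<ge>K. \<forall>j\<ge>k. norm (X j - X k) \<le> r / 2"
      using tail[of "r/2"] by auto
    have "norm (X k - abs_l2 G) < r" if "k \<ge> K" for k
    proof -
      have "ennreal ((norm (abs_l2 G - X k))\<^sup>2) = (\<integral>\<^sup>+x. ennreal ((cmod (G x - F k x))\<^sup>2) \<partial>lborel)"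
        using square_integrable_diff[OF G F(1)[of k]]
        by (simp add: F(2) norm_abs_l2_diff[OF G F(1)] nn_integral_eq_integral square_integrable_def)
      also have "\<dots> \<le> ennreal ((r/2)\<^sup>2)"
        using K that by (intro Fatou) auto
      finally have "(norm (abs_l2 G - X k))\<^sup>2 \<le> (r/2)\<^sup>2"
        by (simp only: ennreal_le_iff zero_le_power2)
      then have "norm (abs_l2 G - X k) \<le> r/2"
        by (rule power2_le_imp_le) (use \<open>r > 0\<close> in simp)
      then show ?thesis using \<open>r > 0\<close> by (simp add: norm_minus_commute)
    qed
    then show "\<exists>no. \<forall>n\<ge>no. norm (X n - abs_l2 G) < r" by blast
  qed
  then show ?thesis by (rule convergentI)
qed

text \<open>Completeness is needed to define \<open>\<phi>(H)\<close> as the sum of a series of spectral projections.\<close>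

instance l2 :: (euclidean_space) banach
proof
  fix X :: "nat \<Rightarrow> 'a l2" assume Cau: "Cauchy X"
  have "\<exists>N. \<forall>m\<ge>N. \<forall>n\<ge>N. norm (X m - X n) < (1/4) ^ k" for k :: nat
    using Cau unfolding Cauchy_iff by simp
  then obtain N where N: "\<And>k m n. m \<ge> N k \<Longrightarrow> n \<ge> N k \<Longrightarrow> norm (X m - X n) < (1/4) ^ k"
    by metis
  define r where "r k = (\<Sum>i\<le>k. N i) + k" for k
  have r: "strict_mono r" by (auto simp: r_def strict_mono_Suc_iff)
  have rN: "N k \<le> r k" for k
    unfolding r_def by (simp add: member_le_sum trans_le_add1)
  have "norm ((X \<circ> r) (Suc k) - (X \<circ> r) k) \<le> (1/4) ^ k" for k
    using N[of k "r (Suc k)" "r k"] rN[of k] strict_monoD[OF r, of k "Suc k"] by simp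
  then have "convergent (X \<circ> r)"
    using Cauchy_subseq_Cauchy[OF Cau r] by (rule l2_fast_Cauchy_convergent)
  then obtain L where "(X \<circ> r) \<longlonglongrightarrow> L" by (auto simp: convergent_def)
  then have "X \<longlonglongrightarrow> L" using Cau r by (metis Cauchy_converges_subseq)
  then show "convergent X" by (rule convergentI)
qed

section \<open>Binary expansions\<close>

text \<open>What is left of \<open>x\<close> after greedily subtracting the powers \<open>1/2, 1/4, \<dots>\<close> that fit: the
binary digits of \<open>x\<close> record which powers were subtracted.\<close>

primrec binary_remainder :: "real \<Rightarrow> nat \<Rightarrow> real" where
  "binary_remainder x 0 = x"
| "binary_remainder x (Suc k) = binary_remainder x k
     - (if (1/2) ^ Suc k \<le> binary_remainder x k then (1/2) ^ Suc k else 0)"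

lemma binary_expansion_sums:
  assumes "0 \<le> x" "x \<le> 1"
  shows "(\<lambda>k. (1/2) ^ Suc k * of_bool ((1/2) ^ Suc k \<le> binary_remainder x k)) sums x"
proof -
  have bounds: "0 \<le> binary_remainder x n \<and> binary_remainder x n \<le> (1/2) ^ n" for n
    by (induction n) (use assms in auto)
  have partial: "(\<Sum>k<n. (1/2) ^ Suc k * of_bool ((1/2) ^ Suc k \<le> binary_remainder x k))
      = x - binary_remainder x n" for n
    by (induction n) auto
  have "binary_remainder x \<longlonglongrightarrow> 0"
    by (rule tendsto_sandwich[of "\<lambda>_. 0" _ _ "\<lambda>n. (1/2) ^ n"])
       (use bounds in \<open>auto intro!: LIMSEQ_power_zero\<close>)
  from tendsto_diff[OF tendsto_const this, of x]
  show ?thesis unfolding sums_def partial by simp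
qed

lemma measurable_binary_remainder [measurable]:
  "(\<lambda>x. binary_remainder x k) \<in> borel_measurable borel"
  by (induction k) simp_all

section \<open>Spectral measures and bounded functional calculus\<close>

locale spectral_measure =
  fixes E :: "real set \<Rightarrow> 'a::euclidean_space l2 \<Rightarrow> 'a l2"
  assumes pvm: "projection_valued_measure E"
begin

lemma E_add: "S \<in> sets borel \<Longrightarrow> E S (f + g) = E S f + E S g"
  using pvm by (auto simp: projection_valued_measure_def clinear_on_def)

lemma E_scaleC: "S \<in> sets borel \<Longrightarrow> E S (c *\<^sub>C f) = c *\<^sub>C E S f"
  using pvm by (auto simp: projection_valued_measure_def clinear_on_def)

lemma E_inner: "S \<in> sets borel \<Longrightarrow> inner (E S f) g = inner f (E S g)"
  using pvm by (auto simp: projection_valued_measure_def inner_l2_def)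

lemma E_Int: "S \<in> sets borel \<Longrightarrow> S' \<in> sets borel \<Longrightarrow> E S (E S' f) = E (S \<inter> S') f"
  using pvm by (auto simp: projection_valued_measure_def)

lemma E_UNIV: "E UNIV f = f"
  using pvm by (auto simp: projection_valued_measure_def)

lemma E_sums:
  "range A \<subseteq> sets borel \<Longrightarrow> disjoint_family A \<Longrightarrow> (\<lambda>i. E (A i) f) sums E (\<Union>i::nat. A i) f"
  using pvm by (auto simp: projection_valued_measure_def)

lemma E_empty: "E {} f = 0"
proof -
  have "(\<lambda>i::nat. E {} f) sums E {} f"
    using E_sums[of "\<lambda>_. {}" f] by (simp add: disjoint_family_on_def)
  then have "(\<lambda>i::nat. E {} f) \<longlonglongrightarrow> 0"
    using sums_summable summable_LIMSEQ_zero by blast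
  then show ?thesis by (simp add: LIMSEQ_const_iff)
qed

lemma E_Un_disjoint:
  assumes "S \<in> sets borel" "S' \<in> sets borel" "S \<inter> S' = {}"
  shows "E (S \<union> S') f = E S f + E S' f"
proof -
  have "(\<lambda>i. E (binaryset S S' i) f) sums E (\<Union>i. binaryset S S' i) f"
  proof (rule E_sums)
    show "disjoint_family (binaryset S S')"
      using assms(3) by (auto simp: disjoint_family_on_def binaryset_def)
  qed (use assms in \<open>simp add: range_binaryset_eq\<close>)
  moreover have "(\<lambda>i. E (binaryset S S' i) f) sums (E S f + E S' f)"
    by (rule binaryset_sums) (rule E_empty)
  ultimately show ?thesis
    by (simp add: UN_binaryset_eq sums_unique2)
qed

lemma inner_E_self: "S \<in> sets borel \<Longrightarrow> inner (E S f) f = (norm (E S f))\<^sup>2"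
  using E_inner[of S "E S f" f] E_Int[of S S f] by (simp add: power2_norm_eq_inner)

lemma norm_E_le:
  assumes "S \<in> sets borel" shows "norm (E S f) \<le> norm f"
proof (cases "E S f = 0")
  case False
  have "norm (E S f) * norm (E S f) \<le> norm (E S f) * norm f"
    using inner_E_self[OF assms, of f] norm_cauchy_schwarz[of "E S f" f] by (simp add: power2_eq_square)
  then show ?thesis using False by simp
qed simp

lemma bounded_linear_E: "S \<in> sets borel \<Longrightarrow> bounded_linear (E S)"
  by (rule bounded_linear_intro[where K=1])
     (auto simp: E_add norm_E_le simp flip: scaleC_of_real intro: E_scaleC)

lemma cinner_E_self:
  assumes "S \<in> sets borel"
  shows "cinner_l2 (E S f) f = complex_of_real ((norm (E S f))\<^sup>2)"
proof -
  have "cinner_l2 (E S f) f = cinner_l2 (E S (E S f)) f"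
    using E_Int[OF assms assms, of f] by simp
  also have "\<dots> = cinner_l2 (E S f) (E S f)"
    using pvm assms by (auto simp: projection_valued_measure_def)
  finally show ?thesis by (simp add: cinner_self)
qed

lemma sets_scalar_measure [simp, measurable_cong]: "sets (scalar_measure E f) = sets borel"
  and space_scalar_measure [simp]: "space (scalar_measure E f) = UNIV"
  unfolding scalar_measure_def
  by (simp_all add: sets_measure_of_conv space_measure_of_conv sets.sigma_sets_eq[of borel, simplified])

lemma emeasure_scalar_measure:
  assumes "S \<in> sets borel"
  shows "emeasure (scalar_measure E f) S = ennreal ((norm (E S f))\<^sup>2)"
proof -
  have eq: "emeasure (scalar_measure E f) S = ennreal (Re (cinner_l2 (E S f) f))"
    unfolding scalar_measure_def
  proof (rule emeasure_measure_of_sigma)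
    show "sigma_algebra UNIV (sets (borel :: real measure))"
      using sets.sigma_algebra_axioms[of "borel :: real measure"] by simp
    show "positive (sets borel) (\<lambda>S. ennreal (Re (cinner_l2 (E S f) f)))"
      using cinner_E_self[of "{}" f] by (simp add: positive_def E_empty)
    show "countably_additive (sets borel) (\<lambda>S. ennreal (Re (cinner_l2 (E S f) f)))"
    proof (rule countably_additiveI)
      fix A :: "nat \<Rightarrow> real set"
      assume A: "range A \<subseteq> sets borel" "disjoint_family A" "(\<Union>i. A i) \<in> sets borel"
      have "(\<lambda>i. inner (E (A i) f) f) sums inner (E (\<Union>i. A i) f) f"
        by (rule bounded_linear.sums[OF bounded_linear_inner_left E_sums[OF A(1,2)]])
      moreover have "0 \<le> inner (E (A i) f) f" for i
        using A(1) by (simp add: inner_E_self range_subsetD)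
      ultimately show "(\<Sum>i. ennreal (Re (cinner_l2 (E (A i) f) f)))
          = ennreal (Re (cinner_l2 (E (\<Union>i. A i) f) f))"
        unfolding inner_l2_def by (intro suminf_ennreal_eq)
    qed
  qed fact
  then show ?thesis using assms by (simp add: cinner_E_self)
qed

lemma finite_measure_scalar_measure: "finite_measure (scalar_measure E f)"
  by (rule finite_measureI) (simp add: emeasure_scalar_measure)

lemma measure_scalar_measure:
  "S \<in> sets borel \<Longrightarrow> measure (scalar_measure E f) S = (norm (E S f))\<^sup>2"
  by (simp add: measure_def emeasure_scalar_measure)

text \<open>Projecting by \<open>E S\<close> concentrates the scalar measure on \<open>S\<close>; pointwise bounds on \<open>S\<close> thereby
become bounds on quadratic forms.\<close>

lemma AE_scalar_measure_E:
  assumes [measurable]: "S \<in> sets borel"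
  shows "AE s in scalar_measure E (E S f). s \<in> S"
proof (rule AE_I[where N="- S"])
  have "E (- S) (E S f) = 0"
    by (simp add: E_Int E_empty)
  then show "emeasure (scalar_measure E (E S f)) (- S) = 0"
    by (simp add: emeasure_scalar_measure)
qed auto

text \<open>Expanding \<open>\<phi>\<close> in binary writes it as \<open>\<Sum> 2\<^sup>-\<^sup>k\<^sup>-\<^sup>1 \<chi>(A\<^sub>k)\<close> with Borel sets \<open>A\<^sub>k\<close>, so that
\<open>T = \<Sum> 2\<^sup>-\<^sup>k\<^sup>-\<^sup>1 E(A\<^sub>k)\<close> converges absolutely. Linearity, symmetry and commutation with every
spectral projection pass from the projections to the sum.\<close>

lemma bounded_functional_calculus_exists:
  assumes [measurable]: "\<phi> \<in> borel_measurable borel" and \<phi>: "\<And>s. 0 \<le> \<phi> s" "\<And>s. \<phi> s \<le> 1"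
  shows "\<exists>T. is_spectral_integral E \<phi> UNIV T
    \<and> (\<forall>S\<in>sets borel. \<forall>f. E S (T f) = T (E S f)) \<and> (\<forall>f g. inner (T f) g = inner f (T g))"
proof -
  define A where "A k = {s. (1/2) ^ Suc k \<le> binary_remainder (\<phi> s) k}" for k
  have A [measurable]: "A k \<in> sets borel" for k
    unfolding A_def by measurable
  have expand: "(\<lambda>k. (1/2) ^ Suc k * indicator (A k) s) sums \<phi> s" for s
    using binary_expansion_sums[OF \<phi>, of s] by (simp add: A_def indicator_def of_bool_def)
  define T where "T f = (\<Sum>k. (1/2) ^ Suc k *\<^sub>R E (A k) f)" for f
  have sm: "summable (\<lambda>k. (1/2) ^ Suc k *\<^sub>R E (A k) f)" for f
  proof (rule summable_norm_cancel, rule summable_comparison_test)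
    show "summable (\<lambda>k. (1/2) ^ Suc k * norm f)"
      by (intro summable_mult2 summable_Suc_iff[THEN iffD2] summable_geometric) auto
    show "\<exists>N. \<forall>n\<ge>N. norm (norm ((1/2) ^ Suc n *\<^sub>R E (A n) f)) \<le> (1/2) ^ Suc n * norm f"
      using norm_E_le[OF A] by (auto intro!: mult_left_mono)
  qed
  then have Ts: "(\<lambda>k. (1/2) ^ Suc k *\<^sub>R E (A k) f) sums T f" for f
    unfolding T_def by (rule summable_sums)
  \<comment> \<open>Commutation, symmetry and the quadratic form come from applying continuous linear maps termwise.\<close>
  have T_image: "(\<lambda>k. (1/2) ^ Suc k *\<^sub>R L (E (A k) f)) sums L (T f)" if "bounded_linear L"
    for f and L :: "'a l2 \<Rightarrow> 'c::real_normed_vector"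
    using bounded_linear.sums[OF that Ts[of f]]
    by (simp add: linear_simps[OF that])
  have lin: "clinear_on UNIV T"
    unfolding clinear_on_def
  proof (intro conjI ballI allI)
    fix f g and c :: complex
    show "T (f + g) = T f + T g"
      using sums_add[OF Ts[of f] Ts[of g]] Ts[of "f + g"]
      by (simp add: E_add scaleR_add_right sums_unique2)
    show "T (c *\<^sub>C f) = c *\<^sub>C T f"
      using T_image[OF bounded_linear_scaleC, of c f] Ts[of "c *\<^sub>C f"]
      by (simp add: E_scaleC sums_unique2)
  qed auto
  have comm: "E S (T f) = T (E S f)" if S: "S \<in> sets borel" for S f
    using T_image[OF bounded_linear_E[OF S], of f] Ts[of "E S f"] S
    by (simp add: E_Int Int_commute sums_unique2)
  have sym: "inner (T f) g = inner f (T g)" for f g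
    using T_image[OF bounded_linear_inner_left[of g], of f] 
      T_image[OF bounded_linear_inner_right[of f], of g]
    by (simp add: E_inner sums_unique2)
  have fin: "emeasure (scalar_measure E f) S < \<infinity>" if "S \<in> sets borel" for f S
    using that by (simp add: emeasure_scalar_measure)
  have quad: "cinner_l2 (T f) f = complex_of_real (LINT s|scalar_measure E f. \<phi> s)" for f
  proof -
    have "(\<lambda>k. LINT s|scalar_measure E f. (1/2) ^ Suc k * indicator (A k) s :: real)
        sums (LINT s|scalar_measure E f. (\<Sum>k. (1/2) ^ Suc k * indicator (A k) s))"
    proof (rule sums_integral)
      show "integrable (scalar_measure E f) (\<lambda>s. (1/2) ^ Suc k * indicator (A k) s :: real)" for k
        using fin[OF A] by (intro integrable_mult_right integrable_real_indicator) auto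
      show "AE s in scalar_measure E f. summable (\<lambda>k. norm ((1/2) ^ Suc k * indicator (A k) s :: real))"
      proof (rule AE_I2)
        fix s
        have "norm ((1/2) ^ Suc k * indicator (A k) s :: real) = (1/2) ^ Suc k * indicator (A k) s" for k
          by (simp add: indicator_def)
        then show "summable (\<lambda>k. norm ((1/2) ^ Suc k * indicator (A k) s :: real))"
          using sums_summable[OF expand[of s]] by presburger
      qed
      show "summable (\<lambda>k. LINT s|scalar_measure E f. norm ((1/2) ^ Suc k * indicator (A k) s :: real))"
      proof (rule summable_comparison_test)
        show "summable (\<lambda>k. (1/2) ^ Suc k * (norm f)\<^sup>2)"
          by (intro summable_mult2 summable_Suc_iff[THEN iffD2] summable_geometric) auto
        show "\<exists>N. \<forall>k\<ge>N. norm (LINT s|scalar_measure E f. norm ((1/2) ^ Suc k * indicator (A k) s :: real))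
            \<le> (1/2) ^ Suc k * (norm f)\<^sup>2"
          by (auto simp: measure_scalar_measure intro!: mult_left_mono power_mono norm_E_le)
      qed
    qed
    moreover have "(\<Sum>k. (1/2) ^ Suc k * indicator (A k) s) = \<phi> s" for s
      by (rule sums_unique[OF expand, symmetric])
    ultimately have "(\<lambda>k. (1/2) ^ Suc k * (norm (E (A k) f))\<^sup>2) sums (LINT s|scalar_measure E f. \<phi> s)"
      by (simp add: measure_scalar_measure)
    then have "(\<lambda>k. complex_of_real ((1/2) ^ Suc k * (norm (E (A k) f))\<^sup>2))
        sums complex_of_real (LINT s|scalar_measure E f. \<phi> s)"
      by (rule sums_of_real)
    moreover have "(\<lambda>k. complex_of_real ((1/2) ^ Suc k * (norm (E (A k) f))\<^sup>2)) sums cinner_l2 (T f) f"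
      using T_image[OF bounded_linear_cinner_left[of f], of f]
      by (simp add: cinner_E_self scaleR_conv_of_real)
    ultimately show ?thesis by (rule sums_unique2[rotated])
  qed
  have "integrable (scalar_measure E f) (\<lambda>s. (\<phi> s)\<^sup>2)" for f
  proof -
    interpret finite_measure "scalar_measure E f" by (rule finite_measure_scalar_measure)
    show ?thesis
      by (rule integrable_const_bound[where B=1]) (use \<phi> in \<open>auto simp: power_le_one\<close>)
  qed
  then have "is_spectral_integral E \<phi> UNIV T"
    unfolding is_spectral_integral_def using lin quad by auto
  with comm sym show ?thesis by blast
qed

text \<open>A complex-linear operator with vanishing quadratic form vanishes, by polarization with \<open>g + h\<close>
and \<open>g + \<i> h\<close>. This is what gives the description in \<open>functional_calculus\<close> its meaning.\<close>

lemma is_spectral_integral_unique: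
  assumes "is_spectral_integral E \<phi> UNIV T" "is_spectral_integral E \<phi> UNIV T'"
  shows "T = T'"
proof
  fix f
  define W where "W h = T h - T' h" for h
  have lin: "W (g + h) = W g + W h" "W (c *\<^sub>C h) = c *\<^sub>C W h" for g h c
  proof -
    have m: "c *\<^sub>C (x - y) = c *\<^sub>C x - c *\<^sub>C y" for x y :: "'a l2"
      by (rule linear_diff[OF bounded_linear.linear[OF bounded_linear_scaleC]])
    show "W (g + h) = W g + W h" "W (c *\<^sub>C h) = c *\<^sub>C W h"
      using assms by (simp_all add: W_def is_spectral_integral_def clinear_on_def m)
  qed
  have zero: "cinner_l2 (W h) h = 0" for h
    using assms by (simp add: W_def is_spectral_integral_def linear_diff[OF bounded_linear.linear[OF bounded_linear_cinner_left]])
  have add_right: "cinner_l2 x (y + z) = cinner_l2 x y + cinner_l2 x z" for x y z :: "'a l2"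
    by (metis cinner_add_left cinner_commute complex_cnj_add)
  have polar: "cinner_l2 (W g) h + cinner_l2 (W h) g = 0" for g h
    using zero[of "g + h"] by (simp add: lin zero cinner_add_left add_right add.commute)
  have "cinner_l2 (W g) h = 0" for g h
    using polar[of g h] polar[of g "\<i> *\<^sub>C h"]
    by (simp add: lin cinner_scaleC_left cinner_scaleC_right)
  then have "norm (W f) = 0"
    using cinner_self[of "W f"] by simp
  then show "T f = T' f" by (simp add: W_def)
qed

lemma functional_calculus_eqI:
  "is_spectral_integral E \<phi> UNIV T \<Longrightarrow> functional_calculus E \<phi> = T"
  unfolding functional_calculus_def by (rule the_equality) (auto intro: is_spectral_integral_unique)

lemma is_spectral_integral_cong_AE:
  assumes "is_spectral_integral E \<phi> D T" "\<And>f. AE s in scalar_measure E f. \<phi> s = \<psi> s"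
    and [measurable]: "\<phi> \<in> borel_measurable borel" "\<psi> \<in> borel_measurable borel"
  shows "is_spectral_integral E \<psi> D T"
proof -
  have "integrable (scalar_measure E f) (\<lambda>s. (\<phi> s)\<^sup>2)
      \<longleftrightarrow> integrable (scalar_measure E f) (\<lambda>s. (\<psi> s)\<^sup>2)" for f
    using assms(2)[of f] by (intro integrable_cong_AE) auto
  moreover have "(LINT s|scalar_measure E f. \<phi> s) = (LINT s|scalar_measure E f. \<psi> s)" for f
    using assms(2)[of f] by (intro integral_cong_AE) auto
  ultimately show ?thesis
    using assms(1) unfolding is_spectral_integral_def by auto
qed

end

section \<open>Localization to a ball\<close>

lemma cutoff_ge_add: "cutoff_ge R (f + g) = cutoff_ge R f + cutoff_ge R g"
  and cutoff_ge_scaleC: "cutoff_ge R (c *\<^sub>C f) = c *\<^sub>C cutoff_ge R f"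
  and cutoff_ge_idem: "cutoff_ge R (cutoff_ge R f) = cutoff_ge R f"
  for f g :: "'a::euclidean_space l2"
proof -
  have cut: "square_integrable (\<lambda>x. indicator {x. R \<le> norm x} x * h x)" if "square_integrable h"
    for h :: "'a \<Rightarrow> complex" and R
  proof -
    have "l2_rel (\<lambda>x. indicator {x. R \<le> norm x} x * h x) (\<lambda>x. indicator {x. R \<le> norm x} x * h x)"
      by (rule rel_funD[OF rel_funD[OF cutoff_ge.rsp refl]]) (use that in \<open>simp add: l2_rel_def\<close>)
    then show ?thesis by (simp only: l2_rel_def)
  qed
  show "cutoff_ge R (f + g) = cutoff_ge R f + cutoff_ge R g"
    by transfer (simp add: l2_rel_def distrib_left square_integrable_add cut)
  show "cutoff_ge R (c *\<^sub>C f) = c *\<^sub>C cutoff_ge R f"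
    by transfer (simp add: l2_rel_def mult.left_commute square_integrable_scale cut)
  show "cutoff_ge R (cutoff_ge R f) = cutoff_ge R f"
    by transfer (simp add: l2_rel_def cut, simp add: indicator_def)
qed

lemma inner_cutoff_ge: "inner (cutoff_ge R f) g = inner f (cutoff_ge R g)"
  unfolding inner_l2_def
  by transfer (auto intro!: arg_cong[where f=Re] Bochner_Integration.integral_cong simp: indicator_def)

lemma cutoff_ge_diff: "cutoff_ge R (f - g) = cutoff_ge R f - cutoff_ge R g"
  using cutoff_ge_add[of R "f - g" g] by (simp add: algebra_simps)

lemma norm_cutoff_ge_split: "(norm f)\<^sup>2 = (norm (cutoff_ge R f))\<^sup>2 + (norm (f - cutoff_ge R f))\<^sup>2"
proof -
  have "inner (cutoff_ge R f) (f - cutoff_ge R f) = 0"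
    by (simp add: inner_cutoff_ge cutoff_ge_diff cutoff_ge_idem)
  then show ?thesis
    by (simp add: power2_norm_eq_inner inner_commute algebra_simps)
qed

lemma norm_cutoff_lt_le_Linf:
  fixes w :: "'a::euclidean_space l2"
  assumes "Linf_norm w \<le> ereal K" "0 \<le> K"
  shows "norm (w - cutoff_ge R w) \<le> K * sqrt (measure lborel (ball (0::'a) R))"
  using assms
proof (transfer fixing: K R)
  fix w :: "'a \<Rightarrow> complex"
  assume w: "l2_rel w w" and K: "esssup lborel (\<lambda>x. ereal (cmod (w x))) \<le> ereal K" "0 \<le> K"
  have "AE x in lborel. ereal (cmod (w x)) \<le> esssup lborel (\<lambda>x. ereal (cmod (w x)))"
    by (rule esssup_AE)
  then have "AE x in lborel. (cmod (w x - indicator {x. R \<le> norm x} x * w x))\<^sup>2 \<le> K\<^sup>2 * indicator (ball 0 R) x"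
  proof eventually_elim
    case (elim x)
    then have "ereal (cmod (w x)) \<le> ereal K" using K(1) by (rule order_trans)
    then show ?case by (auto simp: indicator_def intro: power_mono)
  qed
  moreover have "emeasure lborel (ball (0::'a) R) < \<infinity>"
    by (rule emeasure_bounded_finite) auto
  ultimately have "(LINT x|lborel. (cmod (w x - indicator {x. R \<le> norm x} x * w x))\<^sup>2)
      \<le> (LINT x|lborel. K\<^sup>2 * indicator (ball (0::'a) R) x)"
    by (intro integral_mono_AE') (auto intro!: integrable_mult_right integrable_real_indicator)
  also have "\<dots> = K\<^sup>2 * measure lborel (ball (0::'a) R)"
    by simp
  finally have "sqrt (LINT x|lborel. (cmod (w x - indicator {x. R \<le> norm x} x * w x))\<^sup>2)
      \<le> sqrt (K\<^sup>2 * measure lborel (ball (0::'a) R))"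
    by (rule real_sqrt_le_mono)
  then show "sqrt (LINT x|lborel. (cmod (w x - indicator {x. R \<le> norm x} x * w x))\<^sup>2)
      \<le> K * sqrt (measure lborel (ball (0::'a) R))"
    using K(2) by (simp add: real_sqrt_mult)
qed

text \<open>Inside a ball a bounded function is square integrable, so an \<open>L\<^sup>2 \<rightarrow> L\<^sup>\<infinity>\<close> bound on \<open>T\<close> bounds
\<open>\<chi>(|x| < R) T\<close> on \<open>L\<^sup>2\<close>, with a factor \<open>sqrt |B\<^sub>R|\<close>. Here \<open>f - cutoff_ge R f\<close> is \<open>\<chi>(|x| < R) f\<close>.\<close>

lemma norm_cutoff_lt_le_L2_Linf:
  fixes T :: "'a::euclidean_space l2 \<Rightarrow> 'a l2"
  assumes "clinear_on UNIV T" "L2_Linf_norm T \<le> ereal K" "0 \<le> K"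
  shows "norm (T f - cutoff_ge R (T f)) \<le> K * sqrt (measure lborel (ball (0::'a) R)) * norm f"
proof -
  define c where "c = complex_of_real (norm f)"
  define h where "h = f /\<^sub>R norm f"
  have f: "f = c *\<^sub>C h" unfolding c_def h_def scaleC_of_real by (cases "f = 0") simp_all
  have "norm h \<le> 1" by (cases "f = 0") (simp_all add: h_def)
  then have "Linf_norm (T h) \<le> L2_Linf_norm T"
    unfolding L2_Linf_norm_def by (intro SUP_upper) simp
  with assms(2,3) have *: "norm (T h - cutoff_ge R (T h)) \<le> K * sqrt (measure lborel (ball (0::'a) R))"
    by (intro norm_cutoff_lt_le_Linf) auto
  have "T f = c *\<^sub>C T h"
    using assms(1) unfolding f by (auto simp: clinear_on_def)
  then have "T f = norm f *\<^sub>R T h" "cutoff_ge R (T f) = norm f *\<^sub>R cutoff_ge R (T h)"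
    by (simp_all only: cutoff_ge_scaleC c_def flip: scaleC_of_real)
  then have "T f - cutoff_ge R (T f) = norm f *\<^sub>R (T h - cutoff_ge R (T h))"
    by (simp only: scaleR_diff_right)
  with mult_left_mono[OF *, of "norm f"] show ?thesis by (simp add: mult.commute)
qed

section \<open>Low energies and the heat semigroup\<close>

context spectral_measure begin

text \<open>On the range of \<open>E [a, b]\<close> with \<open>b < 0\<close> the quadratic form of the operator is at most
\<open>b \<parallel>g\<parallel>\<^sup>2\<close>, while it is non-negative by assumption; so this range is trivial. The lower end
\<open>a\<close> keeps \<open>g\<close> in the domain. Countable additivity then covers the negative half-line.\<close>

lemma E_negative_eq_0:
  assumes "nonnegative_op D T" "is_spectral_integral E (\<lambda>s. s) D T"
  shows "E {..<0} f = 0"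
proof -
  have bounded_part: "E {a..b} f = 0" if "b < 0" for a b
  proof -
    define g where "g = E {a..b} f"
    interpret finite_measure "scalar_measure E g" by (rule finite_measure_scalar_measure)
    have AE: "AE s in scalar_measure E g. a \<le> s \<and> s \<le> b"
      unfolding g_def using AE_scalar_measure_E[of "{a..b}" f] by simp
    have "integrable (scalar_measure E g) (\<lambda>s. s\<^sup>2)"
    proof (rule integrable_const_bound[where B="a\<^sup>2"])
      show "AE s in scalar_measure E g. norm (s\<^sup>2) \<le> a\<^sup>2"
        using AE by eventually_elim (use that in \<open>auto simp: abs_le_square_iff[symmetric]\<close>)
    qed simp
    then have g: "g \<in> D" using assms(2) by (simp add: is_spectral_integral_def)
    then have "0 \<le> (LINT s|scalar_measure E g. s)"
      using assms by (auto simp: nonnegative_op_def is_spectral_integral_def)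
    also have "\<dots> \<le> (LINT s|scalar_measure E g. b)"
    proof (rule integral_mono_AE)
      show "integrable (scalar_measure E g) (\<lambda>s. s)"
      proof (rule integrable_const_bound[where B="\<bar>a\<bar>"])
        show "AE s in scalar_measure E g. norm s \<le> \<bar>a\<bar>"
          using AE by eventually_elim (use that in auto)
      qed simp
    qed (use AE in auto)
    also have "\<dots> = b * (norm g)\<^sup>2"
      using measure_scalar_measure[of UNIV g] by (simp add: E_UNIV)
    finally have "(norm g)\<^sup>2 = 0"
      using that by (simp add: zero_le_mult_iff)
    then show ?thesis by (simp add: g_def)
  qed
  have "{..<0} = (\<Union>n. {- real n..- inverse (real (Suc n))})"
  proof (intro equalityI subsetI)
    fix s :: real assume s: "s \<in> {..<0}"
    obtain m where m: "- s \<le> real m" using real_arch_simple by blast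
    obtain n where n: "inverse (real (Suc n)) < - s" using reals_Archimedean[of "- s"] s by auto
    have "inverse (real (Suc (max m n))) \<le> inverse (real (Suc n))"
      by (intro le_imp_inverse_le) auto
    with n have "s \<le> - inverse (real (Suc (max m n)))" by linarith
    moreover have "- real (max m n) \<le> s" using m by simp
    ultimately show "s \<in> (\<Union>n. {- real n..- inverse (real (Suc n))})"
      by (intro UN_I[of "max m n"]) simp_all
  next
    fix s :: real assume "s \<in> (\<Union>n. {- real n..- inverse (real (Suc n))})"
    then obtain n where "s \<le> - inverse (real (Suc n))" by auto
    also have "\<dots> < 0" by simp
    finally show "s \<in> {..<0}" by simp
  qed
  moreover have "emeasure (scalar_measure E f) (\<Union>n. {- real n..- inverse (real (Suc n))}) = 0"
    by (rule emeasure_UN_eq_0) (auto simp: emeasure_scalar_measure bounded_part)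
  ultimately show ?thesis
    by (simp add: emeasure_scalar_measure)
qed

text \<open>The function \<open>exp (- t * s)\<close> is unbounded on the negative half-line, which the spectral measure
does not charge; truncating it at \<open>1\<close> brings it into the range of the bounded calculus.\<close>

lemma heat_semigroup_exists:
  assumes neg: "\<And>f. E {..<0} f = 0" and "0 < t"
  obtains T where "is_spectral_integral E (\<lambda>s. exp (- t * s)) UNIV T"
    "\<And>S f. S \<in> sets borel \<Longrightarrow> E S (T f) = T (E S f)" "\<And>f g. inner (T f) g = inner f (T g)"
proof -
  let ?\<phi> = "\<lambda>s. min 1 (exp (- t * s))"
  obtain T where T: "is_spectral_integral E ?\<phi> UNIV T"
      "\<And>S f. S \<in> sets borel \<Longrightarrow> E S (T f) = T (E S f)" "\<And>f g. inner (T f) g = inner f (T g)"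
    using bounded_functional_calculus_exists[of ?\<phi>] by auto
  have "AE s in scalar_measure E f. ?\<phi> s = exp (- t * s)" for f
  proof (rule AE_I[where N="{..<0}"])
    show "emeasure (scalar_measure E f) {..<0} = 0"
      by (simp add: emeasure_scalar_measure neg)
    show "{s \<in> space (scalar_measure E f). ?\<phi> s \<noteq> exp (- t * s)} \<subseteq> {..<0}"
    proof (rule subsetI, rule ccontr)
      fix s assume s: "s \<in> {s \<in> space (scalar_measure E f). ?\<phi> s \<noteq> exp (- t * s)}" "s \<notin> {..<0}"
      then have "0 \<le> t * s" using \<open>0 < t\<close> by simp
      with s(1) show False by (simp add: min_def split: if_splits)
    qed
  qed simp
  from is_spectral_integral_cong_AE[OF T(1) this]
  have "is_spectral_integral E (\<lambda>s. exp (- t * s)) UNIV T" by simp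
  from that[OF this T(2,3)] show thesis .
qed

text \<open>On energies below \<open>\<delta>\<close> the semigroup is bounded below by \<open>exp (- t * \<delta>)\<close>: the projection \<open>g\<close> of
\<open>u\<close> satisfies \<open>exp (- t * \<delta>) \<parallel>g\<parallel>\<^sup>2 \<le> \<langle>T g, g\<rangle> = \<langle>T u, g\<rangle>\<close>. The last
equality holds because \<open>T\<close> commutes with the projection.\<close>

lemma norm_E_lessThan_le_heat:
  assumes T: "is_spectral_integral E (\<lambda>s. exp (- t * s)) UNIV T"
    and comm: "\<And>S f. S \<in> sets borel \<Longrightarrow> E S (T f) = T (E S f)" and "0 < t"
  shows "norm (E {..<\<delta>} u) \<le> exp (t * \<delta>) * norm (T u)"
proof (cases "E {..<\<delta>} u = 0")
  case False
  define g where "g = E {..<\<delta>} u"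
  interpret finite_measure "scalar_measure E g" by (rule finite_measure_scalar_measure)
  have "integrable (scalar_measure E g) (\<lambda>s. (exp (- t * s))\<^sup>2)"
    using T by (auto simp: is_spectral_integral_def)
  then have int: "integrable (scalar_measure E g) (\<lambda>s. exp (- t * s))"
    by (rule square_integrable_imp_integrable[rotated]) simp
  have "exp (- t * \<delta>) * (norm g)\<^sup>2 = (LINT s|scalar_measure E g. exp (- t * \<delta>))"
    using measure_scalar_measure[of UNIV g] by (simp add: E_UNIV)
  also have "\<dots> \<le> (LINT s|scalar_measure E g. exp (- t * s))"
  proof (rule integral_mono_AE)
    show "AE s in scalar_measure E g. exp (- t * \<delta>) \<le> exp (- t * s)"
      using AE_scalar_measure_E[of "{..<\<delta>}" u] \<open>0 < t\<close>
      unfolding g_def by (auto elim!: eventually_mono)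
  qed (use int in auto)
  also have "\<dots> = inner (T g) g"
    using T by (simp add: is_spectral_integral_def inner_l2_def)
  also have "\<dots> = inner (T u) g"
    by (simp add: g_def E_Int E_inner flip: comm)
  also have "\<dots> \<le> norm (T u) * norm g"
    by (rule norm_cauchy_schwarz)
  finally have "exp (- t * \<delta>) * norm g \<le> norm (T u)"
    using False by (simp add: g_def power2_eq_square flip: mult.assoc)
  then have "exp (t * \<delta>) * (exp (- t * \<delta>) * norm g) \<le> exp (t * \<delta>) * norm (T u)"
    by (intro mult_left_mono) auto
  then show ?thesis by (simp add: g_def flip: mult.assoc exp_add)
qed simp

text \<open>The uncertainty principle: a function of low energy has little mass in a bounded set. With
\<open>P = E {..<\<delta>}\<close>, \<open>Q = \<chi>(|x| < R)\<close> and \<open>u = Q P f\<close>, symmetry gives both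
\<open>\<parallel>u\<parallel>\<^sup>2 = \<langle>P u, f\<rangle>\<close> and \<open>\<parallel>T u\<parallel>\<^sup>2 = \<langle>u, Q T (T u)\<rangle>\<close>. The first is bounded through
\<open>\<parallel>P u\<parallel> \<le> exp (t * \<delta>) \<parallel>T u\<parallel>\<close>, the second through the bound on \<open>Q T\<close>.\<close>

lemma norm_cutoff_lt_E_lessThan_le:
  fixes R :: real
  defines "V \<equiv> measure lborel (ball (0::'a) R)"
  assumes T: "is_spectral_integral E (\<lambda>s. exp (- t * s)) UNIV T"
    and comm: "\<And>S f. S \<in> sets borel \<Longrightarrow> E S (T f) = T (E S f)"
    and sym: "\<And>f g. inner (T f) g = inner f (T g)"
    and "0 < t" and K: "L2_Linf_norm T \<le> ereal K" "0 \<le> K"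
  shows "norm (E {..<\<delta>} f - cutoff_ge R (E {..<\<delta>} f)) \<le> exp (t * \<delta>) * (K * sqrt V) * norm f"
proof -
  define u where "u = E {..<\<delta>} f - cutoff_ge R (E {..<\<delta>} f)"
  \<comment> \<open>As \<open>u\<close> lives in the ball, pairing with \<open>u\<close> does not see values outside the ball.\<close>
  have u0: "cutoff_ge R u = 0"
    by (simp add: u_def cutoff_ge_diff cutoff_ge_idem)
  have inner_u: "inner u (w - cutoff_ge R w) = inner u w" for w
    using inner_cutoff_ge[of R u w] by (simp add: u0 inner_diff_right)
  have lin: "clinear_on UNIV T" using T by (simp add: is_spectral_integral_def)
  have "(norm (T u))\<^sup>2 = inner u (T (T u) - cutoff_ge R (T (T u)))"
    by (simp add: inner_u power2_norm_eq_inner sym)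
  also have "\<dots> \<le> norm u * norm (T (T u) - cutoff_ge R (T (T u)))"
    by (rule norm_cauchy_schwarz)
  also have "\<dots> \<le> norm u * (K * sqrt V * norm (T u))"
    unfolding V_def by (intro mult_left_mono norm_cutoff_lt_le_L2_Linf lin K) auto
  finally have Tu: "norm (T u) \<le> K * sqrt V * norm u"
    using K(2) by (cases "norm (T u) = 0") (auto simp: V_def power2_eq_square mult_ac)
  have "(norm u)\<^sup>2 = inner u (E {..<\<delta>} f)"
    using inner_u[of "E {..<\<delta>} f"] by (simp add: power2_norm_eq_inner u_def)
  also have "\<dots> = inner (E {..<\<delta>} u) f" by (simp add: E_inner)
  also have "\<dots> \<le> norm (E {..<\<delta>} u) * norm f" by (rule norm_cauchy_schwarz)
  also have "\<dots> \<le> exp (t * \<delta>) * (K * sqrt V * norm u) * norm f"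
    using norm_E_lessThan_le_heat[OF T comm \<open>0 < t\<close>, of \<delta> u] Tu
    by (intro mult_right_mono) (auto elim!: order_trans)
  finally have "norm u * norm u \<le> (exp (t * \<delta>) * (K * sqrt V) * norm f) * norm u"
    by (simp add: power2_eq_square mult_ac)
  then have "norm u \<le> exp (t * \<delta>) * (K * sqrt V) * norm f"
    using K(2) by (cases "norm u = 0") (auto simp: V_def)
  then show ?thesis by (simp add: u_def)
qed

end

theorem lemma2p1:
  fixes D :: "(real ^ 'n) l2 set"
    and H :: "(real ^ 'n) l2 \<Rightarrow> (real ^ 'n) l2"
    and E :: "real set \<Rightarrow> (real ^ 'n) l2 \<Rightarrow> (real ^ 'n) l2"
    and \<gamma> C\<^sub>0 :: real
  assumes "self_adjoint D H"
    and "nonnegative_op D H"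
    and "spectral_measure_of D H E"
    and "\<gamma> > 0" and "C\<^sub>0 > 0"
    and "\<forall>t>0. L2_Linf_norm (functional_calculus E (\<lambda>s. exp (- t * s))) \<le> ereal (C\<^sub>0 * t powr (- \<gamma>))"
  shows "\<exists>C>0. \<forall>R>0. \<exists>\<delta>>0. \<forall>f :: (real ^ 'n) l2.
    (norm f)\<^sup>2 \<le> C * ((norm (cutoff_ge R f))\<^sup>2 + (norm (E {\<delta>..} f))\<^sup>2)"
proof (rule exI[of _ 4], intro conjI allI impI)
  fix R :: real assume "R > 0"
  interpret spectral_measure E
    using assms(3) by unfold_locales (simp add: spectral_measure_of_def)
  have neg: "E {..<0} f = 0" for f
    using E_negative_eq_0[OF assms(2)] assms(3) by (simp add: spectral_measure_of_def)
  define V where "V = measure lborel (ball (0::real ^ 'n) R)"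
  \<comment> \<open>For \<open>t = 1 / \<delta>\<close> and \<open>\<delta>\<^sup>\<gamma> = a\<close> the semigroup bound \<open>C\<^sub>0 t\<^sup>-\<^sup>\<gamma>\<close> equals \<open>C\<^sub>0 a\<close>, and this \<open>a\<close>
    brings \<open>\<chi>(|x| < R) E {..<\<delta>}\<close> down to norm at most \<open>1/2\<close>; adding \<open>1\<close> avoids a case distinction
    on \<open>V = 0\<close>.\<close>
  define a where "a = 1 / (2 * exp 1 * C\<^sub>0 * (sqrt V + 1))"
  define \<delta> where "\<delta> = a powr (1 / \<gamma>)"
  have "0 \<le> V" by (simp add: V_def)
  then have "a > 0" using assms(5) by (simp add: a_def add_nonneg_pos)
  then have \<delta>: "\<delta> > 0" "\<delta> powr \<gamma> = a"
    using assms(4) by (simp_all add: \<delta>_def powr_powr)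
  define t where "t = 1 / \<delta>"
  have t: "t > 0" using \<delta> by (simp add: t_def)
  have ta: "t powr (- \<gamma>) = a"
    using \<delta> by (simp add: t_def powr_minus powr_divide)
  obtain T where T: "is_spectral_integral E (\<lambda>s. exp (- t * s)) UNIV T"
      "\<And>S f. S \<in> sets borel \<Longrightarrow> E S (T f) = T (E S f)" "\<And>f g. inner (T f) g = inner f (T g)"
    using heat_semigroup_exists[OF neg t] by blast
  have bound: "L2_Linf_norm T \<le> ereal (C\<^sub>0 * a)"
    using assms(6) t functional_calculus_eqI[OF T(1)] ta by metis
  have small: "exp (t * \<delta>) * (C\<^sub>0 * a * sqrt V) \<le> 1/2"
  proof -
    have "exp (t * \<delta>) * (C\<^sub>0 * a * sqrt V) = sqrt V / (2 * (sqrt V + 1))"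
      using assms(5) \<delta>(1) by (simp add: t_def a_def)
    also have "\<dots> \<le> 1/2"
      using \<open>0 \<le> V\<close> by (simp add: divide_simps add_nonneg_pos)
    finally show ?thesis .
  qed
  show "\<exists>\<delta>>0. \<forall>f :: (real ^ 'n) l2.
    (norm f)\<^sup>2 \<le> 4 * ((norm (cutoff_ge R f))\<^sup>2 + (norm (E {\<delta>..} f))\<^sup>2)"
  proof (intro exI[of _ \<delta>] conjI allI \<delta>(1))
    fix f :: "(real ^ 'n) l2"
    define g h where "g = E {..<\<delta>} f" and "h = E {\<delta>..} f"
    have split: "f = g + h"
    proof -
      have "{..<\<delta>} \<union> {\<delta>..} = UNIV" "{..<\<delta>} \<inter> {\<delta>..} = {}" by auto
      then show ?thesis
        using E_Un_disjoint[of "{..<\<delta>}" "{\<delta>..}" f] by (simp add: g_def h_def E_UNIV)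
    qed
    have "norm (g - cutoff_ge R g) \<le> exp (t * \<delta>) * (C\<^sub>0 * a * sqrt V) * norm f"
      unfolding g_def V_def using \<open>a > 0\<close> assms(5)
      by (intro norm_cutoff_lt_E_lessThan_le[OF T t bound]) auto
    also have "\<dots> \<le> 1/2 * norm f"
      by (rule mult_right_mono[OF small]) simp
    finally have g: "norm (g - cutoff_ge R g) \<le> norm f / 2" by simp
    have h: "norm (h - cutoff_ge R h) \<le> norm h"
      by (rule power2_le_imp_le) (simp_all add: norm_cutoff_ge_split[of h R])
    have "f - cutoff_ge R f = (g - cutoff_ge R g) + (h - cutoff_ge R h)"
      unfolding split cutoff_ge_add by simp
    then have "norm (f - cutoff_ge R f) \<le> norm f / 2 + norm h"
      using g h norm_triangle_ineq[of "g - cutoff_ge R g" "h - cutoff_ge R h"] by simp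
    then have "(norm (f - cutoff_ge R f))\<^sup>2 \<le> (norm f / 2 + norm h)\<^sup>2"
      by (rule power_mono) simp
    also have "\<dots> \<le> (norm f)\<^sup>2 / 2 + 2 * (norm h)\<^sup>2"
      using sum_squares_bound[of "norm f / 2" "norm h"] by (simp add: power2_sum power_divide)
    finally have *: "(norm f)\<^sup>2 \<le> (norm (cutoff_ge R f))\<^sup>2 + ((norm f)\<^sup>2 / 2 + 2 * (norm h)\<^sup>2)"
      using norm_cutoff_ge_split[of f R] by simp
    have "x \<le> 4 * (c + y)" if "x \<le> c + (x / 2 + 2 * y)" "0 \<le> c" for x y c :: real
      using that by simp
    from this[OF *] show "(norm f)\<^sup>2 \<le> 4 * ((norm (cutoff_ge R f))\<^sup>2 + (norm (E {\<delta>..} f))\<^sup>2)"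
      unfolding h_def by simp
  qed
qed simp

end
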